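(* The maximum cardinality of a subset of $\{1,2,3\}^3$ that does not contain all eight vertices of any box is $22$; equivalently, the minimum number of points that must be removed from $\{1,2,3\}^3$ so that the remaining set contains the eight vertices of no box is $5$. Moreover, any two subsets of $\{1,2,3\}^3$ of size $22$ containing the vertex set of no box are equivalent.
   Context: A box in $\{1,\dots,N\}^3$ is a set $\{i_1,i_2\}\times\{j_1,j_2\}\times\{k_1,k_2\}$ with $i_1\neq i_2$, $j_1\neq j_2$, $k_1\neq k_2$. Let $G$ be the group of bijections of $\{1,\dots,N\}^3$ generated by the interchanges of two parallel layers (maps $(i,j,k)\mapsto(\tau(i),j,k)$, $(i,\tau(j),k)$, $(i,j,\tau(k))$ for transpositions $\tau$ of $\{1,\dots,N\}$), the rotational symmetries and the reflectional symmetries of the cube $[1,N]^3$ restricted to its lattice points. Two subsets $S,T$ are equivalent if $T=g(S)$ for some $g\in G$. *)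

theory Defs
  imports
    "HOL-Analysis.Analysis"
    "HOL-Combinatorics.Transposition"
    "HOL-Algebra.Bij"
    "HOL-Algebra.Generated_Groups"
begin

type_synonym point = "nat \<times> nat \<times> nat"

definition grid :: "nat \<Rightarrow> point set" where
  "grid N = {1..N} \<times> {1..N} \<times> {1..N}"

definition is_box :: "nat \<Rightarrow> point set \<Rightarrow> bool" where
  "is_box N B \<longleftrightarrow> (\<exists>i1\<in>{1..N}. \<exists>i2\<in>{1..N}. \<exists>j1\<in>{1..N}. \<exists>j2\<in>{1..N}. \<exists>k1\<in>{1..N}. \<exists>k2\<in>{1..N}.
     i1 \<noteq> i2 \<and> j1 \<noteq> j2 \<and> k1 \<noteq> k2 \<and> B = {i1, i2} \<times> {j1, j2} \<times> {k1, k2})"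

definition box_free :: "nat \<Rightarrow> point set \<Rightarrow> bool" where
  "box_free N S \<longleftrightarrow> \<not> (\<exists>B. is_box N B \<and> B \<subseteq> S)"

definition layer_interchanges :: "nat \<Rightarrow> (point \<Rightarrow> point) set" where
  "layer_interchanges N = (\<Union>a\<in>{1..N}. \<Union>b\<in>{1..N} - {a}.
     {restrict (\<lambda>(i, j, k). (Transposition.transpose a b i, j, k)) (grid N),
      restrict (\<lambda>(i, j, k). (i, Transposition.transpose a b j, k)) (grid N),
      restrict (\<lambda>(i, j, k). (i, j, Transposition.transpose a b k)) (grid N)})"

definition solid_cube :: "nat \<Rightarrow> (real^3) set" where
  "solid_cube N = {x. \<forall>i. x $ i \<in> {1..real N}}"

definition lattice_point :: "point \<Rightarrow> real^3" where
  "lattice_point = (\<lambda>(i, j, k). vector [real i, real j, real k])"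

definition is_rotation :: "(real^3 \<Rightarrow> real^3) \<Rightarrow> bool" where
  "is_rotation f \<longleftrightarrow> (\<exists>A b. rotation_matrix A \<and> f = (\<lambda>x. A *v x + b))"

text \<open>Reflections across an arbitrary plane \<open>{x. n \<bullet> x = c}\<close>, not necessarily through the origin.\<close>

definition is_reflection :: "(real^3 \<Rightarrow> real^3) \<Rightarrow> bool" where
  "is_reflection f \<longleftrightarrow> (\<exists>n c. n \<noteq> 0 \<and> f = (\<lambda>x. x - (2 * (n \<bullet> x - c) / (n \<bullet> n)) *\<^sub>R n))"

text \<open>
  A proper rigid motion that preserves the cube fixes its centre, so it is a rotation about an axis
  through the centre even though \<open>is_rotation\<close> allows any translation part. An isometry that
  preserves the cube maps lattice points of the cube to lattice points, so each \<open>f\<close> below induces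
  exactly one \<open>g\<close>.
\<close>

definition cube_rotations :: "nat \<Rightarrow> (point \<Rightarrow> point) set" where
  "cube_rotations N = {g \<in> Bij (grid N). \<exists>f. is_rotation f \<and> f ` solid_cube N = solid_cube N \<and>
     (\<forall>p\<in>grid N. lattice_point (g p) = f (lattice_point p))}"

definition cube_reflections :: "nat \<Rightarrow> (point \<Rightarrow> point) set" where
  "cube_reflections N = {g \<in> Bij (grid N). \<exists>f. is_reflection f \<and> f ` solid_cube N = solid_cube N \<and>
     (\<forall>p\<in>grid N. lattice_point (g p) = f (lattice_point p))}"

definition grid_group :: "nat \<Rightarrow> (point \<Rightarrow> point) set" where
  "grid_group N = generate (BijGroup (grid N))
     (layer_interchanges N \<union> cube_rotations N \<union> cube_reflections N)"

definition equivalent :: "nat \<Rightarrow> point set \<Rightarrow> point set \<Rightarrow> bool" where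
  "equivalent N S T \<longleftrightarrow> (\<exists>g\<in>grid_group N. T = g ` S)"

end

theory Submission
  imports Defs
begin

text \<open>
  Every box of \<open>{1..3}\<^sup>3\<close> consists of the points that differ in all coordinates from some fixed point
  \<open>(a, b, c)\<close>, so the complement of a box-free set is a set \<open>R\<close> such that every \<open>(a, b, c)\<close> differs in
  all coordinates from some element of \<open>R\<close>. Fixing \<open>a\<close>, the points of \<open>R\<close> outside the layer \<open>a\<close>
  project to a set with the analogous property in the square. Such a planar set has at least
  three points, and if it has exactly three then no two of them share a coordinate. Hence every layer
  contains at most \<open>|R| - 3\<close> points, which gives \<open>|R| \<ge> 5\<close>. If \<open>|R| = 5\<close>, the layers in the first
  direction have 2, 2 and 1 points, and the two planar configurations that contain the single
  point determine \<open>R\<close> up to permutations of the values of each coordinate. Such permutations are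
  products of layer interchanges.
\<close>

section \<open>Boxes and blocking sets in the cube of side 3\<close>

definition blocking :: "point set \<Rightarrow> bool" where
  "blocking R \<longleftrightarrow> (\<forall>a\<in>{1..3}. \<forall>b\<in>{1..3}. \<forall>c\<in>{1..3}. \<exists>(x, y, z)\<in>R. x \<noteq> a \<and> y \<noteq> b \<and> z \<noteq> c)"

definition planar_blocking :: "(nat \<times> nat) set \<Rightarrow> bool" where
  "planar_blocking D \<longleftrightarrow> (\<forall>b\<in>{1..3}. \<forall>c\<in>{1..3}. \<exists>(y, z)\<in>D. y \<noteq> b \<and> z \<noteq> c)"

lemma interval_1_3: "{1..3} = {1, 2, 3::nat}" "{Suc 0..3} = {1, 2, 3::nat}"
  by auto

lemma distinct_pair_eq_Diff:
  fixes a b c :: nat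
  assumes "{a, b, c} \<subseteq> {1..3}" "distinct [a, b, c]"
  shows "{a, b} = {1..3} - {c}"
proof (rule card_subset_eq)
  have "c \<in> {1..3}"
    using assms(1) by blast
  then have "card ({1..3} - {c}) = 2"
    by simp
  then show "card {a, b} = card ({1..3} - {c})"
    using assms(2) by simp
qed (use assms in auto)

lemma finite_grid [simp]: "finite (grid N)"
  by (simp add: grid_def)

lemma card_grid: "card (grid N) = N ^ 3"
  by (simp add: grid_def card_cartesian_product power3_eq_cube)

lemma in_interval_1_3: "a \<in> {1..3} \<longleftrightarrow> a = 1 \<or> a = 2 \<or> a = (3::nat)"
  by auto

lemma interval_1_3_Diff:
  "{1..3} - {1} = {2, 3::nat}" "{1..3} - {2} = {1, 3::nat}" "{1..3} - {3} = {1, 2::nat}"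
  by auto

lemma pair_eq_Diff_singleton:
  assumes "i \<in> {1..3::nat}" "j \<in> {1..3}" "i \<noteq> j"
  shows "\<exists>a\<in>{1..3}. {i, j} = {1..3} - {a}"
proof
  have ij: "1 \<le> i" "i \<le> 3" "1 \<le> j" "j \<le> 3"
    using assms(1,2) by auto
  \<comment> \<open>Since 1 + 2 + 3 = 6, the value omitted by the pair is \<open>6 - i - j\<close>;
    distinctness gives i + j <= 5, so the natural subtraction does not truncate.\<close>
  then have a: "1 \<le> 6 - i - j" "6 - i - j \<le> 3" "6 - i - j \<noteq> i" "6 - i - j \<noteq> j"
    using assms(3) by presburger+
  show "6 - i - j \<in> {1..3}"
    using a(1,2) by (simp only: atLeastAtMost_iff simp_thms)
  then show "{i, j} = {1..3} - {6 - i - j}"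
    using assms a(3,4) by (intro distinct_pair_eq_Diff) (simp_all only: insert_subset empty_subsetI
      distinct.simps list.set insert_iff empty_iff simp_thms, metis)
qed

lemma Diff_singleton_eq_pair:
  assumes "a \<in> {1..3::nat}"
  shows "\<exists>i\<in>{1..3}. \<exists>j\<in>{1..3}. i \<noteq> j \<and> {1..3} - {a} = {i, j}"
  using assms unfolding in_interval_1_3
proof (elim disjE)
  show ?thesis if "a = 1"
    using that interval_1_3_Diff(1) by (intro bexI[of _ 2] bexI[of _ 3]) simp_all
  show ?thesis if "a = 2"
    using that interval_1_3_Diff(2) by (intro bexI[of _ 1] bexI[of _ 3]) simp_all
  show ?thesis if "a = 3"
    using that interval_1_3_Diff(3) by (intro bexI[of _ 1] bexI[of _ 2]) simp_all
qed

text \<open>In each direction a pair from {1..3} omits exactly one value, so a box is encoded by its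
  omitted triple (a, b, c).\<close>

lemma is_box_3_iff:
  "is_box 3 B \<longleftrightarrow> (\<exists>a\<in>{1..3}. \<exists>b\<in>{1..3}. \<exists>c\<in>{1..3}.
     B = ({1..3} - {a}) \<times> ({1..3} - {b}) \<times> ({1..3} - {c}))"
proof
  assume "is_box 3 B"
  then show "\<exists>a\<in>{1..3}. \<exists>b\<in>{1..3}. \<exists>c\<in>{1..3}.
      B = ({1..3} - {a}) \<times> ({1..3} - {b}) \<times> ({1..3} - {c})"
    unfolding is_box_def by (metis pair_eq_Diff_singleton)
next
  assume "\<exists>a\<in>{1..3}. \<exists>b\<in>{1..3}. \<exists>c\<in>{1..3}.
      B = ({1..3} - {a}) \<times> ({1..3} - {b}) \<times> ({1..3} - {c})"
  then show "is_box 3 B"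
    unfolding is_box_def by (metis Diff_singleton_eq_pair)
qed

text \<open>A box lies in the complement of \<open>R\<close> iff it misses \<open>R\<close>. A point
  of \<open>R\<close> that differs from (a, b, c) in all coordinates lies in the box omitting (a, b,
  c), because \<open>R\<close> is contained in the grid.\<close>

lemma box_free_Diff_iff_blocking:
  assumes "R \<subseteq> grid 3"
  shows "box_free 3 (grid 3 - R) \<longleftrightarrow> blocking R"
proof -
  define box where "box a b c = ({1..3} - {a}) \<times> ({1..3} - {b}) \<times> ({1..3} - {c})" for a b c :: nat
  have "box_free 3 (grid 3 - R) \<longleftrightarrow>
      (\<forall>a\<in>{1..3}. \<forall>b\<in>{1..3}. \<forall>c\<in>{1..3}. \<not> box a b c \<subseteq> grid 3 - R)"
    unfolding box_free_def is_box_3_iff box_def[symmetric] by blast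
  moreover have "\<not> box a b c \<subseteq> grid 3 - R \<longleftrightarrow> (\<exists>(x, y, z)\<in>R. x \<noteq> a \<and> y \<noteq> b \<and> z \<noteq> c)" for a b c
    using assms unfolding box_def grid_def by blast
  ultimately show ?thesis
    unfolding blocking_def by simp
qed

section \<open>Planar blocking sets of size at most three\<close>

lemma planar_blockingE:
  assumes "planar_blocking D" "b \<in> {1..3}" "c \<in> {1..3}"
  obtains y z where "(y, z) \<in> D" "y \<noteq> b" "z \<noteq> c"
  using assms unfolding planar_blocking_def by blast

text \<open>The position (\<open>fst u\<close>, \<open>snd v\<close>) shares a coordinate with each
  of the two points.\<close>

lemma not_planar_blocking_pair:
  assumes "u \<in> {1..3} \<times> {1..3}" "v \<in> {1..3} \<times> {1..3}"
  shows "\<not> planar_blocking {u, v}"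
proof
  assume "planar_blocking {u, v}"
  then obtain y z where "(y, z) \<in> {u, v}" "y \<noteq> fst u" "z \<noteq> snd v"
    using assms by (elim planar_blockingE[of _ "fst u" "snd v"]) (simp_all add: mem_Times_iff)
  then show False
    by auto
qed

lemma card_planar_blocking:
  assumes "D \<subseteq> {1..3} \<times> {1..3}" "planar_blocking D"
  shows "3 \<le> card D"
proof (rule ccontr)
  assume "\<not> 3 \<le> card D"
  moreover have "finite D"
    using assms(1) by (rule finite_subset) simp
  moreover have "D \<noteq> {}"
    using assms(2) by (fastforce simp: planar_blocking_def)
  ultimately have "card D \<noteq> 0" "card D < 3"
    by auto
  then have "card D = 1 \<or> card D = 2"
    by linarith
  \<comment> \<open>A singleton is covered as the degenerate pair u = v.\<close>
  then obtain u v where "D = {u, v}"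
    by (metis card_1_singletonE card_2_iff insert_absorb2)
  then show False
    using not_planar_blocking_pair[of u v] assms by auto
qed

text \<open>If \<open>u\<close> and \<open>v\<close> had the same first coordinate, the position
  (\<open>fst u\<close>, \<open>snd w\<close>) would share a coordinate with all three
  points.\<close>

lemma planar_blocking_triple_fst_neq:
  assumes "planar_blocking {u, v, w}" "u \<in> {1..3} \<times> {1..3}" "w \<in> {1..3} \<times> {1..3}"
  shows "fst u \<noteq> fst v"
proof
  assume "fst u = fst v"
  moreover obtain y z where "(y, z) \<in> {u, v, w}" "y \<noteq> fst u" "z \<noteq> snd w"
    using assms by (elim planar_blockingE[of _ "fst u" "snd w"]) (simp_all add: mem_Times_iff)
  ultimately show False
    by auto
qed

lemma planar_blocking_triple_snd_neq:
  assumes "planar_blocking {u, v, w}" "u \<in> {1..3} \<times> {1..3}" "w \<in> {1..3} \<times> {1..3}"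
  shows "snd u \<noteq> snd v"
proof
  assume "snd u = snd v"
  moreover obtain y z where "(y, z) \<in> {u, v, w}" "y \<noteq> fst w" "z \<noteq> snd u"
    using assms by (elim planar_blockingE[of _ "fst w" "snd u"]) (simp_all add: mem_Times_iff)
  ultimately show False
    by auto
qed

lemma planar_blocking_triple:
  assumes "planar_blocking {(y1, z1), (y2, z2), (y3, z3)}"
    and "{(y1, z1), (y2, z2), (y3, z3)} \<subseteq> {1..3} \<times> {1..3}"
  shows "distinct [y1, y2, y3]" "distinct [z1, z2, z3]"
proof -
  \<comment> \<open>The reorderings bring each of the other two pairs into the first two places,
    where the preceding lemmas compare coordinates.\<close>
  have perms: "planar_blocking {(y1, z1), (y3, z3), (y2, z2)}"
      "planar_blocking {(y2, z2), (y3, z3), (y1, z1)}"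
    using assms(1) by (simp_all add: insert_commute)
  show "distinct [y1, y2, y3]"
    using planar_blocking_triple_fst_neq[OF assms(1)] perms[THEN planar_blocking_triple_fst_neq]
      assms(2) by auto
  show "distinct [z1, z2, z3]"
    using planar_blocking_triple_snd_neq[OF assms(1)] perms[THEN planar_blocking_triple_snd_neq]
      assms(2) by auto
qed

section \<open>Layers and the lower bound 5\<close>

definition layer :: "point set \<Rightarrow> nat \<Rightarrow> point set" where
  "layer R a = {p \<in> R. fst p = a}"

lemma planar_blocking_snd_Diff_layer:
  assumes "blocking R" "a \<in> {1..3}"
  shows "planar_blocking (snd ` (R - layer R a))"
  unfolding planar_blocking_def
proof (intro ballI)
  fix b c :: nat
  assume "b \<in> {1..3}" "c \<in> {1..3}"
  then obtain x y z where "(x, y, z) \<in> R" "x \<noteq> a" "y \<noteq> b" "z \<noteq> c"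
    using assms unfolding blocking_def by blast
  then show "\<exists>(y, z)\<in>snd ` (R - layer R a). y \<noteq> b \<and> z \<noteq> c"
    unfolding layer_def by force
qed

lemma snd_grid_subset: "R \<subseteq> grid N \<Longrightarrow> snd ` R \<subseteq> {1..N} \<times> {1..N}"
  unfolding grid_def by auto

text \<open>The points outside layer \<open>a\<close> project to a planar blocking set, which has at
  least three elements; projection can only merge points, so at least three points lie outside the
  layer.\<close>

lemma card_layer_le:
  assumes "R \<subseteq> grid 3" "blocking R" "a \<in> {1..3}"
  shows "card (layer R a) + 3 \<le> card R"
proof -
  have fin: "finite R"
    using assms(1) finite_grid by (rule finite_subset)
  have sub: "layer R a \<subseteq> R"
    by (auto simp: layer_def)
  have "3 \<le> card (snd ` (R - layer R a))"
    using planar_blocking_snd_Diff_layer[OF assms(2,3)] snd_grid_subset[OF assms(1)]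
    by (intro card_planar_blocking) auto
  also have "\<dots> \<le> card (R - layer R a)"
    using fin by (intro card_image_le) auto
  also have "\<dots> = card R - card (layer R a)"
    using fin sub by (meson card_Diff_subset finite_subset)
  finally show ?thesis
    using card_mono[OF fin sub] by linarith
qed

lemma card_eq_sum_layers:
  assumes "R \<subseteq> grid 3"
  shows "card R = card (layer R 1) + card (layer R 2) + card (layer R 3)"
proof -
  have "finite R"
    using assms finite_grid by (rule finite_subset)
  moreover have "fst ` R \<subseteq> {1..3}"
    using assms by (auto simp: grid_def)
  \<comment> \<open>The cardinality is a sum of ones, grouped by the fibres of
    \<open>fst\<close>.\<close>
  ultimately have "card R = (\<Sum>a\<in>{1..3}. card (layer R a))"
    unfolding layer_def using sum.group[of R "{1..3}" fst "\<lambda>_. 1::nat"] by simp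
  then show ?thesis
    unfolding interval_1_3 by simp
qed

text \<open>Adding the three layer bounds gives |R| + 9 <= 3|R|, so |R| >= 9/2, and integrality
  gives 5.\<close>

lemma card_blocking:
  assumes "R \<subseteq> grid 3" "blocking R"
  shows "5 \<le> card R"
  using card_layer_le[OF assms, of 1] card_layer_le[OF assms, of 2] card_layer_le[OF assms, of 3]
    card_eq_sum_layers[OF assms(1)] by simp

section \<open>Classification of the blocking sets of size 5\<close>

text \<open>Each layer has at most 5 - 3 = 2 points, and three such numbers with sum 5 are 2, 2, 1
  in some order; \<open>x3\<close> names the layer with a single point.\<close>

lemma three_layers_221:
  assumes "R \<subseteq> grid 3" "blocking R" "card R = 5"
  obtains x1 x2 x3 where "{x1, x2, x3} = {1..3}" "distinct [x1, x2, x3]"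
    "card (layer R x1) = 2" "card (layer R x2) = 2" "card (layer R x3) = 1"
proof -
  have "card (layer R 1) \<le> 2" "card (layer R 2) \<le> 2" "card (layer R 3) \<le> 2"
    using card_layer_le[OF assms(1,2), of 1] card_layer_le[OF assms(1,2), of 2]
      card_layer_le[OF assms(1,2), of 3] assms(3) by auto
  then consider "card (layer R 1) = 1" "card (layer R 2) = 2" "card (layer R 3) = 2"
    | "card (layer R 1) = 2" "card (layer R 2) = 1" "card (layer R 3) = 2"
    | "card (layer R 1) = 2" "card (layer R 2) = 2" "card (layer R 3) = 1"
    using card_eq_sum_layers[OF assms(1)] assms(3) by linarith
  then show thesis
  proof cases
    case 1
    then show thesis using that[of 2 3 1] by (auto simp: interval_1_3)
  next
    case 2
    then show thesis using that[of 1 3 2] by (auto simp: interval_1_3)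
  next
    case 3
    then show thesis using that[of 1 2 3] by (auto simp: interval_1_3)
  qed
qed

lemma layer_eq_pairE:
  assumes "card (layer R a) = 2"
  obtains y z y' z' where "layer R a = {(a, y, z), (a, y', z')}"
proof -
  obtain p q where pq: "layer R a = {p, q}"
    using assms by (metis card_2_iff)
  then have "fst p = a" "fst q = a"
    by (auto simp: layer_def)
  then show thesis
    using that[of "fst (snd p)" "snd (snd p)" "fst (snd q)" "snd (snd q)"] pq
    by (cases p; cases q) auto
qed

lemma layer_eq_singletonE:
  assumes "card (layer R a) = 1"
  obtains y z where "layer R a = {(a, y, z)}"
proof -
  obtain p where p: "layer R a = {p}"
    using assms by (metis card_1_singletonE)
  then have "fst p = a"
    by (auto simp: layer_def)
  then show thesis
    using that[of "fst (snd p)" "snd (snd p)"] p by (cases p) auto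
qed

text \<open>For permutations of {1..3}, the first four points are alternate vertices of a 2 by 2 by
  2 box, forming an inscribed tetrahedron; the fifth differs from all of them in every
  coordinate.\<close>

definition pattern :: "(nat \<Rightarrow> nat) \<Rightarrow> (nat \<Rightarrow> nat) \<Rightarrow> (nat \<Rightarrow> nat) \<Rightarrow> point set" where
  "pattern x y z = {(x 1, y 1, z 1), (x 1, y 2, z 2), (x 2, y 1, z 2), (x 2, y 2, z 1), (x 3, y 3, z 3)}"

lemma permutes_obtain:
  assumes "u1 \<in> {1..3::nat}" "u2 \<in> {1..3}" "u3 \<in> {1..3}" "distinct [u1, u2, u3]"
  obtains p where "p permutes {1..3}" "p 1 = u1" "p 2 = u2" "p 3 = u3"
proof
  \<comment> \<open>Updating \<open>id\<close> keeps every number outside {1..3} fixed, as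
    \<open>permutes\<close> demands.\<close>
  define p where "p = id(1 := u1, 2 := u2, 3 := u3)"
  show "p 1 = u1" "p 2 = u2" "p 3 = u3"
    by (simp_all add: p_def)
  have "p ` {1, 2, 3} = {u1, u2, u3}" "inj_on p {1, 2, 3}"
    using assms(4) by (simp_all add: p_def)
  then have "p ` {1..3} \<subseteq> {1..3}" "inj_on p {1..3}"
    using assms(1-3) unfolding interval_1_3(1) by blast+
  then have "bij_betw p {1..3} {1..3}"
    by (simp add: bij_betw_def endo_inj_surj)
  then show "p permutes {1..3}"
    by (rule bij_imp_permutes) (auto simp: p_def)
qed

lemma blocking_card_5_pattern:
  assumes "R \<subseteq> grid 3" "blocking R" "card R = 5"
  obtains x y z where "x permutes {1..3}" "y permutes {1..3}" "z permutes {1..3}" "R = pattern x y z"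
proof -
  obtain x1 x2 x3 where x: "{x1, x2, x3} = {1..3}" "distinct [x1, x2, x3]"
    and cards: "card (layer R x1) = 2" "card (layer R x2) = 2" "card (layer R x3) = 1"
    using three_layers_221[OF assms] .
  obtain y1 z1 y2 z2 where L1: "layer R x1 = {(x1, y1, z1), (x1, y2, z2)}"
    using layer_eq_pairE[OF cards(1)] .
  obtain v1 w1 v2 w2 where L2: "layer R x2 = {(x2, v1, w1), (x2, v2, w2)}"
    using layer_eq_pairE[OF cards(2)] .
  obtain y3 z3 where L3: "layer R x3 = {(x3, y3, z3)}"
    using layer_eq_singletonE[OF cards(3)] .
  have xs: "x1 \<in> {1..3}" "x2 \<in> {1..3}" "x3 \<in> {1..3}"
    using x(1) by auto
  have "fst p \<in> {x1, x2, x3}" if "p \<in> R" for p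
    using that assms(1) unfolding x(1) by (auto simp: grid_def)
  then have layers: "R = layer R x1 \<union> layer R x2 \<union> layer R x3"
    by (auto simp: layer_def)
  have "R - layer R x2 = layer R x1 \<union> layer R x3" "R - layer R x1 = layer R x2 \<union> layer R x3"
    using layers x(2) by (auto simp: layer_def)
  then have "snd ` (R - layer R x2) = {(y1, z1), (y2, z2), (y3, z3)}"
    "snd ` (R - layer R x1) = {(v1, w1), (v2, w2), (y3, z3)}"
    unfolding L1 L2 L3 by auto
  \<comment> \<open>Removing either two-point layer leaves three points, so both projections are
    blocking triples, and they share the point (y3, z3).\<close>
  then have blk: "planar_blocking {(y1, z1), (y2, z2), (y3, z3)}"
    "planar_blocking {(v1, w1), (v2, w2), (y3, z3)}"
    using planar_blocking_snd_Diff_layer[OF assms(2)] xs by metis+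
  have R: "R = {(x1, y1, z1), (x1, y2, z2), (x2, v1, w1), (x2, v2, w2), (x3, y3, z3)}"
    using layers unfolding L1 L2 L3 by auto
  then have mem: "{y1, y2, y3, v1, v2} \<subseteq> {1..3}" "{z1, z2, z3, w1, w2} \<subseteq> {1..3}"
    using assms(1) by (auto simp: grid_def)
  have dist: "distinct [y1, y2, y3]" "distinct [z1, z2, z3]"
    using planar_blocking_triple[OF blk(1)] mem by simp_all
  have dist': "distinct [v1, v2, y3]" "distinct [w1, w2, z3]"
    using planar_blocking_triple[OF blk(2)] mem by simp_all
  \<comment> \<open>Both pairs are the complement of \<open>y3\<close> in {1..3}.\<close>
  have "{v1, v2} = {y1, y2}"
    using distinct_pair_eq_Diff[OF _ dist(1)] distinct_pair_eq_Diff[OF _ dist'(1)] mem(1) by simp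
  then have v: "v1 = y1 \<and> v2 = y2 \<or> v1 = y2 \<and> v2 = y1"
    by (simp only: doubleton_eq_iff)
  have "{w1, w2} = {z1, z2}"
    using distinct_pair_eq_Diff[OF _ dist(2)] distinct_pair_eq_Diff[OF _ dist'(2)] mem(2) by simp
  then have w: "w1 = z1 \<and> w2 = z2 \<or> w1 = z2 \<and> w2 = z1"
    by (simp only: doubleton_eq_iff)
  \<comment> \<open>If the two layers had equal projections, (x3, y1, z2) would be unblocked: points
    over (y1, z1) share \<open>y1\<close>, points over (y2, z2) share \<open>z2\<close>, and the
    last point shares \<open>x3\<close>. Only the crossed matching of the coordinates
    remains.\<close>
  have "{(v1, w1), (v2, w2)} \<noteq> {(y1, z1), (y2, z2)}"
  proof
    assume "{(v1, w1), (v2, w2)} = {(y1, z1), (y2, z2)}"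
    then have "\<not> (\<exists>(x, y, z)\<in>R. x \<noteq> x3 \<and> y \<noteq> y1 \<and> z \<noteq> z2)"
      unfolding R using dist by (auto simp: doubleton_eq_iff)
    then show False
      using assms(2) xs mem unfolding blocking_def by blast
  qed
  then have "{(v1, w1), (v2, w2)} = {(y1, z2), (y2, z1)}"
    using v w by auto
  then have R': "R = {(x1, y1, z1), (x1, y2, z2), (x2, y1, z2), (x2, y2, z1), (x3, y3, z3)}"
    unfolding R by (auto simp: doubleton_eq_iff)
  obtain x where "x permutes {1..3}" "x 1 = x1" "x 2 = x2" "x 3 = x3"
    using permutes_obtain[of x1 x2 x3] xs x(2) by blast
  moreover obtain y where "y permutes {1..3}" "y 1 = y1" "y 2 = y2" "y 3 = y3"
    using permutes_obtain[of y1 y2 y3] mem dist by auto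
  moreover obtain z where "z permutes {1..3}" "z 1 = z1" "z 2 = z2" "z 3 = z3"
    using permutes_obtain[of z1 z2 z3] mem dist by auto
  ultimately show thesis
    using that R' by (simp add: pattern_def)
qed

text \<open>This reference configuration shows that the bound 5 is attained.\<close>

lemma pattern_id: "pattern id id id \<subseteq> grid 3" "card (pattern id id id) = 5"
    "blocking (pattern id id id)"
  by (simp_all add: pattern_def grid_def blocking_def interval_1_3)

section \<open>Coordinate permutations as elements of the group\<close>

text \<open>The map is left unrestricted so that composition is an unconditional equation; it is
  restricted to the grid only as an element of the group.\<close>

definition coord_map :: "(nat \<Rightarrow> nat) \<Rightarrow> (nat \<Rightarrow> nat) \<Rightarrow> (nat \<Rightarrow> nat) \<Rightarrow> point \<Rightarrow> point" where
  "coord_map p q r = map_prod p (map_prod q r)"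

lemma coord_map_comp:
  "coord_map p q r \<circ> coord_map p' q' r' = coord_map (p \<circ> p') (q \<circ> q') (r \<circ> r')"
  by (simp add: coord_map_def map_prod.comp)

lemma pattern_eq_image: "pattern x y z = coord_map x y z ` pattern id id id"
  by (simp add: pattern_def coord_map_def)

lemma inj_coord_map:
  "p permutes A \<Longrightarrow> q permutes A \<Longrightarrow> r permutes A \<Longrightarrow> inj (coord_map p q r)"
  unfolding coord_map_def by (intro prod.inj_map) (simp_all add: permutes_inj)

lemma coord_map_image_grid:
  assumes "p permutes {1..N}" "q permutes {1..N}" "r permutes {1..N}"
  shows "coord_map p q r ` grid N = grid N"
  using assms by (simp add: coord_map_def grid_def map_prod_surj_on permutes_image)

lemma coord_map_Bij:
  assumes "p permutes {1..N}" "q permutes {1..N}" "r permutes {1..N}"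
  shows "restrict (coord_map p q r) (grid N) \<in> Bij (grid N)"
  using inj_coord_map[OF assms, THEN inj_on_subset, of "grid N"] coord_map_image_grid[OF assms]
  by (simp add: Bij_def bij_betw_def)

text \<open>The right factor maps the grid into itself, so restricting before or after composing
  gives the same map.\<close>

lemma coord_map_mult:
  assumes "p permutes {1..N}" "q permutes {1..N}" "r permutes {1..N}"
    and "p' permutes {1..N}" "q' permutes {1..N}" "r' permutes {1..N}"
  shows "restrict (coord_map p q r) (grid N) \<otimes>\<^bsub>BijGroup (grid N)\<^esub> restrict (coord_map p' q' r') (grid N)
    = restrict (coord_map (p \<circ> p') (q \<circ> q') (r \<circ> r')) (grid N)"
proof -
  have "coord_map p' q' r' v \<in> grid N" if "v \<in> grid N" for v
    using that coord_map_image_grid[OF assms(4-6)] by blast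
  then have "compose (grid N) (restrict (coord_map p q r) (grid N)) (restrict (coord_map p' q' r') (grid N))
      = restrict (coord_map p q r \<circ> coord_map p' q' r') (grid N)"
    by (auto simp: compose_def fun_eq_iff restrict_def)
  then show ?thesis
    using coord_map_Bij[OF assms(1-3)] coord_map_Bij[OF assms(4-6)]
    by (simp add: BijGroup_def coord_map_comp)
qed

lemma coord_map_comp_in_grid_group:
  assumes "p permutes {1..N}" "q permutes {1..N}" "r permutes {1..N}"
    and "p' permutes {1..N}" "q' permutes {1..N}" "r' permutes {1..N}"
    and "restrict (coord_map p q r) (grid N) \<in> grid_group N"
    and "restrict (coord_map p' q' r') (grid N) \<in> grid_group N"
  shows "restrict (coord_map (p \<circ> p') (q \<circ> q') (r \<circ> r')) (grid N) \<in> grid_group N"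
  using generate.eng[OF assms(7,8)[unfolded grid_group_def]]
  unfolding coord_map_mult[OF assms(1-6)] grid_group_def .

lemma coord_map_id_in_grid_group:
  "restrict (coord_map id id id) (grid N) \<in> grid_group N"
  using generate.one[of "BijGroup (grid N)"]
  by (simp add: coord_map_def prod.map_id0 grid_group_def BijGroup_def id_def)

lemma coord_map_transpose_in_grid_group:
  assumes "a \<in> {1..N}" "b \<in> {1..N}" "a \<noteq> b"
  shows "restrict (coord_map (Transposition.transpose a b) id id) (grid N) \<in> grid_group N"
    "restrict (coord_map id (Transposition.transpose a b) id) (grid N) \<in> grid_group N"
    "restrict (coord_map id id (Transposition.transpose a b)) (grid N) \<in> grid_group N"
proof -
  let ?t = "Transposition.transpose a b"
  have "coord_map ?t id id = (\<lambda>(i, j, k). (?t i, j, k))"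
    "coord_map id ?t id = (\<lambda>(i, j, k). (i, ?t j, k))"
    "coord_map id id ?t = (\<lambda>(i, j, k). (i, j, ?t k))"
    by (auto simp: coord_map_def)
  then have "restrict (coord_map ?t id id) (grid N) \<in> layer_interchanges N"
    "restrict (coord_map id ?t id) (grid N) \<in> layer_interchanges N"
    "restrict (coord_map id id ?t) (grid N) \<in> layer_interchanges N"
    unfolding layer_interchanges_def using assms by (intro UN_I[of a] UN_I[of b]; simp)+
  then show "restrict (coord_map ?t id id) (grid N) \<in> grid_group N"
    "restrict (coord_map id ?t id) (grid N) \<in> grid_group N"
    "restrict (coord_map id id ?t) (grid N) \<in> grid_group N"
    unfolding grid_group_def by (auto intro: generate.incl)
qed

text \<open>A permutation of a finite set is a product of transpositions, and a transposition in one
  coordinate is a layer interchange. One induction serves all three directions.\<close>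

lemma coord_map_single_in_grid_group:
  assumes "p permutes {1..N}"
  shows "restrict (coord_map p id id) (grid N) \<in> grid_group N
    \<and> restrict (coord_map id p id) (grid N) \<in> grid_group N
    \<and> restrict (coord_map id id p) (grid N) \<in> grid_group N"
  using assms finite_atLeastAtMost
proof (induction rule: permutes_induct)
  case id
  show ?case using coord_map_id_in_grid_group by blast
next
  case (swap a b p)
  note t = permutes_swap_id[OF swap.hyps(1,2)]
  note id = permutes_id[of "{1..N}"]
  show ?case
    using coord_map_comp_in_grid_group[OF t id id swap.hyps(4) id id]
      coord_map_comp_in_grid_group[OF id t id id swap.hyps(4) id]
      coord_map_comp_in_grid_group[OF id id t id id swap.hyps(4)]
      coord_map_transpose_in_grid_group[OF swap.hyps(1-3)] swap.IH
    by (simp only: comp_id simp_thms)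
qed

text \<open>The map is the product of three maps that each permute a single coordinate.\<close>

lemma coord_map_in_grid_group:
  assumes "p permutes {1..N}" "q permutes {1..N}" "r permutes {1..N}"
  shows "restrict (coord_map p q r) (grid N) \<in> grid_group N"
proof -
  note id = permutes_id[of "{1..N}"]
  have "restrict (coord_map p q id) (grid N) \<in> grid_group N"
    using coord_map_comp_in_grid_group[OF assms(1) id id id assms(2) id]
      coord_map_single_in_grid_group[OF assms(1)] coord_map_single_in_grid_group[OF assms(2)]
    by simp
  then show ?thesis
    using coord_map_comp_in_grid_group[OF assms(1,2) id id id assms(3)]
      coord_map_single_in_grid_group[OF assms(3)] by simp
qed

text \<open>The first coordinate map is undone to return to \<open>S0\<close>, and then the second
  is applied.\<close>

lemma equivalent_coord_map_images:
  assumes S0: "S0 \<subseteq> grid N"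
    and f: "p permutes {1..N}" "q permutes {1..N}" "r permutes {1..N}"
    and g: "p' permutes {1..N}" "q' permutes {1..N}" "r' permutes {1..N}"
  shows "equivalent N (coord_map p q r ` S0) (coord_map p' q' r' ` S0)"
proof -
  let ?h = "coord_map (p' \<circ> inv_into UNIV p) (q' \<circ> inv_into UNIV q) (r' \<circ> inv_into UNIV r)"
  have "restrict ?h (grid N) \<in> grid_group N"
    using f g by (intro coord_map_in_grid_group permutes_compose permutes_inv)
  moreover have "?h \<circ> coord_map p q r = coord_map p' q' r'"
    using f[THEN permutes_inv_o(2)] by (simp add: coord_map_comp comp_assoc)
  then have "?h ` coord_map p q r ` S0 = coord_map p' q' r' ` S0"
    by (simp only: image_comp)
  moreover have "restrict ?h (grid N) ` coord_map p q r ` S0 = ?h ` coord_map p q r ` S0"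
    using S0 coord_map_image_grid[OF f] by (intro image_cong) auto
  ultimately show ?thesis
    unfolding equivalent_def by (intro bexI[of _ "restrict ?h (grid N)"]) (simp_all only:)
qed

section \<open>Box-free sets of size 22 and the final result\<close>

text \<open>The complement of \<open>S\<close> is a blocking set of size 27 - 22 = 5, hence an image
  of the reference pattern. A coordinate permutation preserves the grid and so commutes with
  complements, which makes \<open>S\<close> an image of one fixed set.\<close>

lemma box_free_card_22_image:
  assumes "S \<subseteq> grid 3" "box_free 3 S" "card S = 22"
  obtains x y z where "x permutes {1..3}" "y permutes {1..3}" "z permutes {1..3}"
    "S = coord_map x y z ` (grid 3 - pattern id id id)"
proof -
  have S: "grid 3 - (grid 3 - S) = S"
    using assms(1) by blast
  have "blocking (grid 3 - S)"
    using box_free_Diff_iff_blocking[of "grid 3 - S"] assms(2) S by simp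
  moreover have "card (grid 3 - S) = 5"
    using assms by (simp add: card_Diff_subset finite_subset[OF _ finite_grid] card_grid)
  ultimately obtain x y z where p: "x permutes {1..3}" "y permutes {1..3}" "z permutes {1..3}"
    and eq: "grid 3 - S = pattern x y z"
    using blocking_card_5_pattern[of "grid 3 - S"] by blast
  have "S = grid 3 - coord_map x y z ` pattern id id id"
    using S eq pattern_eq_image by metis
  also have "\<dots> = coord_map x y z ` (grid 3 - pattern id id id)"
    using inj_coord_map[OF p] coord_map_image_grid[OF p] by (simp add: image_set_diff)
  finally show thesis
    using that p by blast
qed

theorem theorem2:
  shows "Max (card ` {S. S \<subseteq> grid 3 \<and> box_free 3 S}) = 22
    \<and> Min (card ` {R. R \<subseteq> grid 3 \<and> box_free 3 (grid 3 - R)}) = 5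
    \<and> (\<forall>S T. S \<subseteq> grid 3 \<and> T \<subseteq> grid 3 \<and> card S = 22 \<and> card T = 22 \<and> box_free 3 S \<and> box_free 3 T
          \<longrightarrow> equivalent 3 S T)"
proof (intro conjI allI impI)
  let ?R = "pattern id id id"
  \<comment> \<open>The predicate stays free so that one finiteness fact serves both
    \<open>Max\<close> and \<open>Min\<close>.\<close>
  have fin: "finite (card ` {S. S \<subseteq> grid 3 \<and> P S})" for P
    by simp
  have free: "box_free 3 (grid 3 - ?R)"
    using pattern_id by (simp add: box_free_Diff_iff_blocking)
  have card: "card (grid 3 - S) = 27 - card S" if "S \<subseteq> grid 3" for S
    using that by (simp add: card_Diff_subset finite_subset[OF _ finite_grid] card_grid)
  have le: "card S \<le> 22" if "S \<subseteq> grid 3" "box_free 3 S" for S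
  proof -
    have "grid 3 - (grid 3 - S) = S"
      using that(1) by blast
    then have "5 \<le> card (grid 3 - S)"
      using box_free_Diff_iff_blocking[of "grid 3 - S"] that(2) by (intro card_blocking) auto
    then show ?thesis
      using card[OF that(1)] by linarith
  qed
  show "Max (card ` {S. S \<subseteq> grid 3 \<and> box_free 3 S}) = 22"
  proof (rule Max_eqI[OF fin])
    show "22 \<in> card ` {S. S \<subseteq> grid 3 \<and> box_free 3 S}"
      using free card[of ?R] pattern_id by (intro image_eqI[of _ _ "grid 3 - ?R"]) auto
  qed (use le in auto)
  show "Min (card ` {R. R \<subseteq> grid 3 \<and> box_free 3 (grid 3 - R)}) = 5"
  proof (rule Min_eqI[OF fin])
    show "5 \<in> card ` {R. R \<subseteq> grid 3 \<and> box_free 3 (grid 3 - R)}"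
      using free pattern_id by (intro image_eqI[of _ _ ?R]) auto
  qed (auto simp: box_free_Diff_iff_blocking card_blocking)
  fix S T
  assume asm: "S \<subseteq> grid 3 \<and> T \<subseteq> grid 3 \<and> card S = 22 \<and> card T = 22 \<and> box_free 3 S \<and> box_free 3 T"
  obtain x y z where "x permutes {1..3}" "y permutes {1..3}" "z permutes {1..3}"
    "S = coord_map x y z ` (grid 3 - ?R)"
    using box_free_card_22_image[of S] asm by blast
  moreover obtain x' y' z' where "x' permutes {1..3}" "y' permutes {1..3}" "z' permutes {1..3}"
    "T = coord_map x' y' z' ` (grid 3 - ?R)"
    using box_free_card_22_image[of T] asm by blast
  ultimately show "equivalent 3 S T"
    using equivalent_coord_map_images[of "grid 3 - ?R" 3] by blast
qed

end
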